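(* Let $n\ge 2$ be an integer and $P_{2n}(x) = x^{2n} - x^{n+1} - x^n - x^{n-1} + 1$. Then there is a unique real root $\alpha_n$ of $P_{2n}(x)$ in the interval $(\sqrt[n]{2}, \sqrt[n]{3})$, and the house of $P_{2n}(x)$ is equal to $\alpha_n$.
   Context: The house of a polynomial is the maximum modulus of its complex roots. *)

theory Defs
  imports "HOL-Computational_Algebra.Computational_Algebra"
begin

(* For nonconstant p the set of roots is finite and nonempty, so Max is the true
   maximum; for constant p the value is unspecified. *)
definition house :: "complex poly \<Rightarrow> real" where
  "house p = Max (cmod ` {z. poly p z = 0})"

(* The exponent n - 1 is truncated subtraction, so this is as intended only for n \<ge> 1. *)
definition P2n :: "nat \<Rightarrow> int poly" where
  "P2n n = monom 1 (2 * n) - monom 1 (n + 1) - monom 1 n - monom 1 (n - 1) + 1"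

end

(* Dividing by z^n turns the equation into z^n + 1/z^n = 1 + z + 1/z. For real x > 1 it says
   (x^(n-1) - 1) * (x - 1/x^n) = 1, whose left side is strictly increasing; this gives the unique
   real root. For a complex root z = r * cis t with r > 1, put R = r^n. Imaginary parts give
   (R - 1/R) * sin (n*t) = (r - 1/r) * sin t, hence |sin (n*t)| <= |sin t|; comparing squared moduli,
   (R + 1/R)^2 - 4 * sin^2 (n*t) = (1 + r + 1/r)^2 - 2 * (r + 1/r) * (1 - cos t) - 4 * sin^2 t,
   gives R + 1/R <= 1 + r + 1/r, which by monotonicity says that r is at most the real root. *)
theory Submission
  imports Defs
begin

lemma poly_P2n:
  "poly (map_poly of_int (P2n n)) x = x ^ (2 * n) - x ^ (n + 1) - x ^ n - x ^ (n - 1) + 1"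
  for x :: "'a :: comm_ring_1"
proof -
  have "map_poly (of_int :: int \<Rightarrow> 'a) (P2n n) =
      monom 1 (2 * n) - monom 1 (n + 1) - monom 1 n - monom 1 (n - 1) + 1"
    by (rule poly_eqI) (simp add: coeff_map_poly P2n_def)
  then show ?thesis by (simp add: poly_monom)
qed

lemma poly_P2n_reciprocal:
  fixes x :: "'a :: field"
  assumes "x \<noteq> 0" "n \<ge> 1"
  shows "poly (map_poly of_int (P2n n)) x = x ^ n * ((x ^ n + 1 / x ^ n) - (1 + x + 1 / x))"
proof -
  have "x ^ (n - 1) = x ^ n / x" "x ^ (2 * n) = x ^ n * x ^ n"
    using assms by (simp_all add: power_diff mult_2 power_add)
  then show ?thesis using assms(1)
    unfolding poly_P2n by (simp add: algebra_simps)
qed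

text \<open>In the reciprocal form both \<open>x ^ n + 1 / x ^ n\<close> and
  \<open>1 + x + 1 / x\<close> grow for x > 1, so their difference shows no monotonicity. Regrouping
  its terms as a product of two increasing factors makes it visible.\<close>

lemma poly_P2n_product:
  fixes x :: real
  assumes "x > 0" "n \<ge> 1"
  shows "poly (map_poly real_of_int (P2n n)) x = x ^ n * ((x ^ (n - 1) - 1) * (x - 1 / x ^ n) - 1)"
proof -
  have "x ^ (n - 1) = x ^ n / x"
    using assms by (simp add: power_diff)
  then have "(x ^ (n - 1) - 1) * (x - 1 / x ^ n) - 1 = (x ^ n + 1 / x ^ n) - (1 + x + 1 / x)"
    using assms(1) by (simp add: algebra_simps)
  then show ?thesis using assms by (simp add: poly_P2n_reciprocal)
qed

text \<open>Both factors are positive and increasing beyond 1. For n = 1 the first factor would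
  vanish identically, hence n \<ge> 2.\<close>

lemma product_strict_mono:
  fixes x y :: real
  assumes "1 < x" "x < y" "n \<ge> 2"
  shows "(x ^ (n - 1) - 1) * (x - 1 / x ^ n) < (y ^ (n - 1) - 1) * (y - 1 / y ^ n)"
proof (rule mult_strict_mono)
  show "x ^ (n - 1) - 1 < y ^ (n - 1) - 1"
    using assms by (simp add: power_strict_mono)
  have "1 / y ^ n \<le> 1 / x ^ n"
    using assms by (intro divide_left_mono power_mono) auto
  then show "x - 1 / x ^ n < y - 1 / y ^ n" using assms by linarith
  have "1 < y ^ (n - 1)" using assms by (intro one_less_power) auto
  then show "0 < y ^ (n - 1) - 1" by simp
  have "1 / x ^ n \<le> 1" using assms by simp
  then show "0 \<le> x - 1 / x ^ n" using assms by linarith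
qed

text \<open>Allowing any nonpositive value at r serves two purposes: applied to two roots in both
  orders it gives uniqueness, and applied to the modulus of a complex root it gives the bound on the
  house.\<close>

lemma P2n_nonpos_imp_le_root:
  fixes r \<alpha> :: real
  assumes "n \<ge> 2" "1 < r" "1 < \<alpha>"
    and "poly (map_poly real_of_int (P2n n)) r \<le> 0"
    and "poly (map_poly real_of_int (P2n n)) \<alpha> = 0"
  shows "r \<le> \<alpha>"
proof (rule ccontr)
  assume "\<not> r \<le> \<alpha>"
  then have "(\<alpha> ^ (n - 1) - 1) * (\<alpha> - 1 / \<alpha> ^ n) < (r ^ (n - 1) - 1) * (r - 1 / r ^ n)"
    using assms by (intro product_strict_mono) auto
  moreover have "(\<alpha> ^ (n - 1) - 1) * (\<alpha> - 1 / \<alpha> ^ n) = 1"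
    using assms(1,3,5) by (simp add: poly_P2n_product)
  moreover have "(r ^ (n - 1) - 1) * (r - 1 / r ^ n) \<le> 1"
    using assms(1,2,4) by (auto simp: poly_P2n_product mult_le_0_iff power_le_zero_eq)
  ultimately show False by linarith
qed

lemma add_inverse_rcis:
  assumes "r > 0"
  shows "Re (rcis r t + 1 / rcis r t) = (r + 1 / r) * cos t"
    and "Im (rcis r t + 1 / rcis r t) = (r - 1 / r) * sin t"
proof -
  have "1 / rcis r t = rcis (1 / r) (- t)"
    by (simp add: rcis_inverse divide_inverse)
  then show "Re (rcis r t + 1 / rcis r t) = (r + 1 / r) * cos t"
    and "Im (rcis r t + 1 / rcis r t) = (r - 1 / r) * sin t"
    by (simp_all add: algebra_simps)
qed

text \<open>After division by R > 0 the conclusion is the inequality R + 1/R \<le> 1 + r + 1/r, that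
  is \<open>C \<le> 1 + c\<close> below.\<close>

lemma complex_root_imp_P2n_norm_nonpos:
  fixes z :: complex
  assumes "n \<ge> 1" "cmod z > 1"
    and "poly (map_poly of_int (P2n n)) z = 0"
  shows "poly (map_poly real_of_int (P2n n)) (cmod z) \<le> 0"
proof -
  define r where "r = cmod z"
  define R where "R = r ^ n"
  define t where "t = Arg z"
  have z: "z = rcis r t" by (simp add: r_def t_def rcis_cmod_Arg)
  have u: "z ^ n = rcis R (n * t)" by (simp add: z R_def DeMoivre2)
  have r: "r > 1" using assms(2) by (simp add: r_def)
  have "r ^ 1 \<le> r ^ n" using r assms(1) by (intro power_increasing) auto
  then have R: "r \<le> R" by (simp add: R_def)
  have "z \<noteq> 0" using assms(2) by auto
  then have eq: "z ^ n + 1 / z ^ n = 1 + (z + 1 / z)"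
    using assms(1,3) by (simp add: poly_P2n_reciprocal add.assoc)
  define a b A B where "a = cos t" "b = sin t" "A = cos (n * t)" "B = sin (n * t)"
  note ab = this
  have re: "(R + 1 / R) * A = 1 + (r + 1 / r) * a"
    using arg_cong[OF eq, of Re] add_inverse_rcis(1)[of R "n * t"] add_inverse_rcis(1)[of r t] r R
    unfolding u[symmetric] z[symmetric] ab by simp
  have im: "(R - 1 / R) * B = (r - 1 / r) * b"
    using arg_cong[OF eq, of Im] add_inverse_rcis(2)[of R "n * t"] add_inverse_rcis(2)[of r t] r R
    unfolding u[symmetric] z[symmetric] ab by simp
  have circ: "a\<^sup>2 + b\<^sup>2 = 1" "A\<^sup>2 + B\<^sup>2 = 1" by (simp_all add: ab)
  define c C where "c = r + 1 / r" and "C = R + 1 / R"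
  define s S where "s = r - 1 / r" and "S = R - 1 / R"
  \<comment> \<open>These identities eliminate \<open>s\<close> and \<open>S\<close> from the
    squared moduli, leaving only \<open>c\<close>, \<open>C\<close> and the sines.\<close>
  have sq: "s\<^sup>2 = c\<^sup>2 - 4" "S\<^sup>2 = C\<^sup>2 - 4"
    using r R by (simp_all add: c_def C_def s_def S_def power2_sum power2_diff)
  note re = re[folded c_def C_def] and im = im[folded s_def S_def]
  have "1 / R \<le> 1 / r" "1 / r < 1" using r R by (simp_all add: frac_le)
  then have sS: "0 < s" "s \<le> S" using r R unfolding s_def S_def by linarith+
  have c: "c > 0" using r by (simp add: c_def add_pos_pos)
  have "s * \<bar>B\<bar> \<le> S * \<bar>B\<bar>"
    using sS by (intro mult_right_mono) auto
  also have "\<dots> = s * \<bar>b\<bar>"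
    using arg_cong[OF im, of abs] sS by (simp add: abs_mult)
  finally have "\<bar>B\<bar> \<le> \<bar>b\<bar>" using sS(1) by simp
  then have Bb: "B\<^sup>2 \<le> b\<^sup>2" by (simp add: abs_le_square_iff)
  have "a \<le> 1" by (simp add: ab)
  then have nonneg: "0 \<le> c * (1 - a)" using c by simp
  \<comment> \<open>\<open>C * A\<close> and \<open>S * B\<close> are the real and imaginary parts
    of z^n + 1/z^n, so the right side is its squared modulus.\<close>
  have "C\<^sup>2 - 4 * B\<^sup>2 = (C * A)\<^sup>2 + (S * B)\<^sup>2"
    using arg_cong[OF circ(2), of "\<lambda>x. C\<^sup>2 * x"]
    by (simp add: sq algebra_simps)
  also have "\<dots> = (1 + c * a)\<^sup>2 + (s * b)\<^sup>2"
    by (simp only: re im)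
  also have "\<dots> = (1 + c)\<^sup>2 - 2 * (c * (1 - a)) - 4 * b\<^sup>2"
    using arg_cong[OF circ(1), of "\<lambda>x. c\<^sup>2 * x"]
    by (simp add: sq power2_sum algebra_simps)
  finally have "C\<^sup>2 \<le> (1 + c)\<^sup>2" using Bb nonneg by linarith
  then have "C \<le> 1 + c"
    by (rule power2_le_imp_le) (use c in simp)
  then show ?thesis
    using r assms(1) unfolding r_def[symmetric]
    by (subst poly_P2n_reciprocal) (auto simp: R_def C_def c_def mult_le_0_iff)
qed

text \<open>At \<open>root n 3\<close> the sum x^n + 1/x^n is 10/3, so the polynomial is positive
  there exactly when x + 1/x < 7/3. The bound x^2 \<le> 3 comes from n \<ge> 2.\<close>

lemma add_inverse_less_7_3:
  fixes x :: real
  assumes "1 < x" "x\<^sup>2 \<le> 3"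
  shows "x + 1 / x < 7 / 3"
proof -
  \<comment> \<open>7/4 is a rational upper bound for the square root of 3, and between 4/7 and 7/4
    the sum x + 1/x is at most 7/4 + 4/7 = 65/28 < 7/3.\<close>
  have "x \<le> 7 / 4"
    by (rule power2_le_imp_le) (use assms in \<open>auto simp: power2_eq_square\<close>)
  then have "(x - 4 / 7) * (x - 7 / 4) \<le> 0"
    using assms by (simp add: mult_nonneg_nonpos)
  then show ?thesis using assms by (simp add: field_simps power2_eq_square)
qed

theorem theorem1:
  fixes n :: nat
  assumes "n \<ge> 2"
  shows "\<exists>\<alpha>::real.
    {x. root n 2 < x \<and> x < root n 3 \<and> poly (map_poly real_of_int (P2n n)) x = 0} = {\<alpha>} \<and>
    house (map_poly (of_int :: int \<Rightarrow> complex) (P2n n)) = \<alpha>"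
proof -
  let ?p = "map_poly real_of_int (P2n n)"
  let ?q = "map_poly (of_int :: int \<Rightarrow> complex) (P2n n)"
  define x y where "x = root n 2" and "y = root n 3"
  have x: "x > 1" "x ^ n = 2" and y: "y > 1" "y ^ n = 3" and xy: "x < y"
    using assms by (auto simp: x_def y_def)
  have px: "poly ?p x < 0"
  proof -
    \<comment> \<open>Here x^n + 1/x^n = 5/2, while 1 + x + 1/x exceeds 3.\<close>
    have "x + 1 / x - 2 = (x - 1)\<^sup>2 / x"
      using x by (simp add: field_simps power2_eq_square)
    also have "\<dots> > 0" using x by simp
    finally have "x + 1 / x > 2" by simp
    then show ?thesis using x assms by (simp add: poly_P2n_reciprocal)
  qed
  have py: "poly ?p y > 0"
  proof -
    have "y ^ 2 \<le> y ^ n" using y assms by (intro power_increasing) auto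
    then have "y + 1 / y < 7 / 3" using y by (intro add_inverse_less_7_3) auto
    then show ?thesis using y assms by (simp add: poly_P2n_reciprocal)
  qed
  obtain \<alpha> where \<alpha>: "x < \<alpha>" "\<alpha> < y" "poly ?p \<alpha> = 0"
    using poly_IVT_pos[OF xy px py] by blast
  have \<alpha>1: "\<alpha> > 1" using \<alpha> x by linarith
  have uniq: "\<beta> = \<alpha>" if "x < \<beta>" "poly ?p \<beta> = 0" for \<beta>
    using P2n_nonpos_imp_le_root[of n \<beta> \<alpha>] P2n_nonpos_imp_le_root[of n \<alpha> \<beta>] that \<alpha> \<alpha>1 x assms
    by simp
  have bound: "cmod z \<le> \<alpha>" if "poly ?q z = 0" for z
  proof (cases "cmod z > 1")
    case True
    have "poly ?p (cmod z) \<le> 0"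
      using assms True that by (intro complex_root_imp_P2n_norm_nonpos) simp_all
    then show ?thesis
      using P2n_nonpos_imp_le_root[OF assms True \<alpha>1] \<alpha>(3) by blast
  qed (use \<alpha>1 in linarith)
  have "poly ?q (of_real \<alpha>) = of_real (poly ?p \<alpha>)"
    by (simp add: poly_P2n)
  then have root: "poly ?q (of_real \<alpha>) = 0" using \<alpha>(3) by simp
  \<comment> \<open>The value at 0 is 1, because n - 1 > 0. So the polynomial is nonzero and its
    root set is finite, as \<open>Max\<close> requires.\<close>
  have "poly ?q 0 \<noteq> 0" using assms by (simp add: poly_P2n power_0_left)
  then have "?q \<noteq> 0" by force
  then have fin: "finite {z. poly ?q z = 0}" by (rule poly_roots_finite)
  have "house ?q = \<alpha>"
    unfolding house_def
  proof (rule Max_eqI)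
    show "\<alpha> \<in> cmod ` {z. poly ?q z = 0}"
      using root \<alpha>1 by (intro image_eqI[of _ _ "of_real \<alpha>"]) auto
  qed (use fin bound in auto)
  moreover have "{x. root n 2 < x \<and> x < root n 3 \<and> poly ?p x = 0} = {\<alpha>}"
    using \<alpha> uniq unfolding x_def y_def by blast
  ultimately show ?thesis by blast
qed

end
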